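(* Let $\mathcal{B}$ be a connected building set on a finite set $E$ such that for any two exchangeable building blocks $B,B'\in\mathcal{B}$, the intersection $B\cap B'$ belongs to $\mathcal{B}\cup\{\varnothing\}$. Then the normal fan of the removahedron $\mathrm{Remo}(\mathcal{B})$ is the $\mathcal{B}$-nested fan $\mathcal{F}(\mathcal{B})$.
   Context: A building set on $E$ is a collection $\mathcal{B}$ of non-empty subsets of $E$ such that if $B,B'\in\mathcal{B}$ with $B\cap B'\ne\varnothing$ then $B\cup B'\in\mathcal{B}$, and all singletons belong to $\mathcal{B}$; it is connected if $E\in\mathcal{B}$. A $\mathcal{B}$-nested set is a subset $\mathcal{N}\subseteq\mathcal{B}\setminus\{E\}$ such that (N1) any two elements of $\mathcal{N}$ are nested or disjoint, and (N2) for any $k\ge2$ pairwise disjoint $N_1,\dots,N_k\in\mathcal{N}$, $N_1\cup\dots\cup N_k\notin\mathcal{B}$. Two elements $B,B'\in\mathcal{B}$ are exchangeable if there exist two maximal (for inclusion) $\mathcal{B}$-nested sets $\mathcal{N},\mathcal{N}'$ such that $\mathcal{N}\setminus\{B\}=\mathcal{N}'\setminus\{B'\}$. For $R\subseteq E$ put $\mathbb{1}_R=\sum_{r\in R}e_r$; let $V=\{x\in\mathbb{R}^E:\sum_s x_s=0\}$ and $\bar{\mathbb{1}}_R$ the orthogonal projection of $\mathbb{1}_R$ onto $V$. The $\mathcal{B}$-nested fan $\mathcal{F}(\mathcal{B})$ is the collection of cones $\mathrm{cone}\{\bar{\mathbb{1}}_N:N\in\mathcal{N}\}$ over all $\mathcal{B}$-nested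 sets $\mathcal{N}$. The removahedron is $\mathrm{Remo}(\mathcal{B})=\{x\in\mathbb{R}^E:\sum_{s\in E}x_s=\binom{|E|+1}{2},\ \sum_{s\in B}x_s\ge\binom{|B|+1}{2}\ \forall B\in\mathcal{B}\}$. For a polytope $P$ in a translate of $V$, the normal cone of a non-empty face $F$ is $\{c\in V:\langle c,x\rangle\le\langle c,y\rangle\ \forall x\in F,y\in P\}$; the normal fan is the collection of these cones. *)

theory Defs
  imports "HOL-Analysis.Analysis"
begin

definition building_set :: "'e set \<Rightarrow> 'e set set \<Rightarrow> bool" where
  "building_set E \<B> \<longleftrightarrow>
     \<B> \<subseteq> Pow E - {{}} \<and>
     (\<forall>B\<in>\<B>. \<forall>B'\<in>\<B>. B \<inter> B' \<noteq> {} \<longrightarrow> B \<union> B' \<in> \<B>) \<and>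
     (\<forall>s\<in>E. {s} \<in> \<B>)"

definition connected_building_set :: "'e set \<Rightarrow> 'e set set \<Rightarrow> bool" where
  "connected_building_set E \<B> \<longleftrightarrow> building_set E \<B> \<and> E \<in> \<B>"

text \<open>Since the elements of \<open>N\<close> are non-empty, pairwise disjoint \<open>N\<^sub>1, \<dots>, N\<^sub>k\<close> are
  automatically distinct, so the families in the second nestedness condition are subsets of \<open>N\<close>
  (all of them finite when \<open>E\<close> is).\<close>

definition nested_set :: "'e set \<Rightarrow> 'e set set \<Rightarrow> 'e set set \<Rightarrow> bool" where
  "nested_set E \<B> N \<longleftrightarrow>
     N \<subseteq> \<B> - {E} \<and>
     (\<forall>A\<in>N. \<forall>B\<in>N. A \<subseteq> B \<or> B \<subseteq> A \<or> A \<inter> B = {}) \<and>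
     (\<forall>S. S \<subseteq> N \<and> 2 \<le> card S \<and> disjoint S \<longrightarrow> \<Union>S \<notin> \<B>)"

definition maximal_nested_set :: "'e set \<Rightarrow> 'e set set \<Rightarrow> 'e set set \<Rightarrow> bool" where
  "maximal_nested_set E \<B> N \<longleftrightarrow>
     nested_set E \<B> N \<and> (\<forall>M. nested_set E \<B> M \<and> N \<subseteq> M \<longrightarrow> M = N)"

text \<open>The conditions \<open>B \<in> N\<close> and \<open>B' \<in> N'\<close> make explicit that \<open>B\<close> is exchanged for \<open>B'\<close>.
  Without them, the equation \<open>N - {B} = N' - {B'}\<close> would hold trivially for \<open>N = N'\<close> and any two
  blocks outside \<open>N\<close>.\<close>

definition exchangeable :: "'e set \<Rightarrow> 'e set set \<Rightarrow> 'e set \<Rightarrow> 'e set \<Rightarrow> bool" where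
  "exchangeable E \<B> B B' \<longleftrightarrow>
     (\<exists>N N'. maximal_nested_set E \<B> N \<and> maximal_nested_set E \<B> N' \<and>
        B \<in> N \<and> B' \<in> N' \<and> N - {B} = N' - {B'})"

text \<open>In the geometric part the ground set is the index type of \<open>real ^ 'e\<close>.\<close>

definition char_vec :: "'e::finite set \<Rightarrow> real ^ 'e" where
  "char_vec R = (\<Sum>r\<in>R. axis r 1)"

definition sum_zero_space :: "(real ^ 'e::finite) set" where
  "sum_zero_space = {x. (\<Sum>s\<in>UNIV. x $ s) = 0}"

definition orth_proj :: "'a::real_inner set \<Rightarrow> 'a \<Rightarrow> 'a" where
  "orth_proj V x = (THE v. v \<in> V \<and> (\<forall>w\<in>V. orthogonal (x - v) w))"

definition proj_char_vec :: "'e::finite set \<Rightarrow> real ^ 'e" where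
  "proj_char_vec R = orth_proj sum_zero_space (char_vec R)"

text \<open>\<open>convex_cone hull\<close> of the empty set is \<open>{0}\<close>, the cone of the empty nested set.\<close>

definition nested_fan :: "'e::finite set set \<Rightarrow> (real ^ 'e) set set" where
  "nested_fan \<B> = {convex_cone hull (proj_char_vec ` N) | N. nested_set UNIV \<B> N}"

definition removahedron :: "'e::finite set set \<Rightarrow> (real ^ 'e) set" where
  "removahedron \<B> =
     {x. (\<Sum>s\<in>UNIV. x $ s) = real ((CARD('e) + 1) choose 2) \<and>
         (\<forall>B\<in>\<B>. (\<Sum>s\<in>B. x $ s) \<ge> real ((card B + 1) choose 2))}"

text \<open>Inner normal cones, taken inside the linear space \<open>V\<close> parallel to the affine space that
  carries \<open>P\<close>.\<close>

definition normal_cone :: "'a::real_inner set \<Rightarrow> 'a set \<Rightarrow> 'a set \<Rightarrow> 'a set" where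
  "normal_cone V P F = {c \<in> V. \<forall>x\<in>F. \<forall>y\<in>P. c \<bullet> x \<le> c \<bullet> y}"

definition normal_fan :: "'a::real_inner set \<Rightarrow> 'a set \<Rightarrow> 'a set set" where
  "normal_fan V P = {normal_cone V P F | F. F face_of P \<and> F \<noteq> {}}"

end

theory Submission
  imports Defs
begin

text \<open>
  Write \<open>f B\<close> for the right-hand side of the inequality of a block \<open>B\<close>, and extend \<open>f\<close> to a function
  \<open>g\<close> on all subsets by summing over the maximal blocks contained in a set (its components). Then
  the removahedron is the base polyhedron \<open>{x. x(E) = g(E), x(S) \<ge> g(S) for all S}\<close>. The condition on
  exchangeable blocks is what makes \<open>g\<close> supermodular: comparing \<open>g\<close> on \<open>R\<close>, \<open>R \<union> {a}\<close>, \<open>R \<union> {b}\<close>,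
  \<open>R \<union> {a, b}\<close> involves the component of \<open>a\<close> in \<open>R \<union> {a}\<close> and that of \<open>b\<close> in \<open>R \<union> {b}\<close>, and if \<open>a\<close>
  and \<open>b\<close> become connected in \<open>R \<union> {a, b}\<close> these two blocks are exchanged by a flip, the two maximal
  nested sets coming from linear orders that differ by swapping \<open>a\<close> and \<open>b\<close>. By the greedy algorithm
  there are points of the removahedron at which all members of a given nested set \<open>N\<close>, but not a given
  further block, are tight. On the other hand every vector of \<open>V\<close> is a positive combination over
  some nested set, formed by the components of its superlevel sets. So the faces are exactly the
  sets on which a nested set is tight, and their normal cones are the cones of the nested fan.
\<close>

section \<open>Triangular numbers and elementary facts on nested sets\<close>

text \<open>The \<open>f\<close> of the overview, defined on all sets because
  \<open>ghat_le_tri\<close> evaluates it beyond blocks.\<close>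

definition tri :: "'e set \<Rightarrow> real" where
  "tri S = real ((card S + 1) choose 2)"

lemma tri_eq: "tri S = real (card S) * (real (card S) + 1) / 2"
proof -
  have "2 * ((card S + 1) choose 2) = card S * (card S + 1)"
    by (simp add: choose_two)
  then have "2 * tri S = real (card S * (card S + 1))"
    unfolding tri_def by (metis of_nat_mult of_nat_numeral)
  then show ?thesis by (simp add: algebra_simps)
qed

lemma tri_empty [simp]: "tri {} = 0"
  by (simp add: tri_eq)

lemma nested_setD:
  assumes "nested_set E \<B> N"
  shows "N \<subseteq> \<B>" "E \<notin> N"
    "\<And>A B. A \<in> N \<Longrightarrow> B \<in> N \<Longrightarrow> A \<subseteq> B \<or> B \<subseteq> A \<or> A \<inter> B = {}"
    "\<And>S. S \<subseteq> N \<Longrightarrow> 2 \<le> card S \<Longrightarrow> disjoint S \<Longrightarrow> \<Union>S \<notin> \<B>"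
  using assms unfolding nested_set_def by blast+

lemma nested_set_subset: "nested_set E \<B> N \<Longrightarrow> M \<subseteq> N \<Longrightarrow> nested_set E \<B> M"
  unfolding nested_set_def by (meson subset_iff)

section \<open>Components with respect to a building set\<close>

locale connected_building =
  fixes \<B> :: "'e::finite set set"
  assumes connected: "connected_building_set UNIV \<B>"
begin

lemma block_nonempty: "B \<in> \<B> \<Longrightarrow> B \<noteq> {}"
  and block_union: "A \<in> \<B> \<Longrightarrow> B \<in> \<B> \<Longrightarrow> A \<inter> B \<noteq> {} \<Longrightarrow> A \<union> B \<in> \<B>"
  and block_singleton: "{s} \<in> \<B>"
  and block_UNIV: "UNIV \<in> \<B>"
  using connected unfolding connected_building_set_def building_set_def by auto

text \<open>Absorbing every block of \<open>S\<close> that it meets is, for a building set, the same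
  as being a maximal block in \<open>S\<close>; this form gives disjointness at once.\<close>

definition comps :: "'e set \<Rightarrow> 'e set set" where
  "comps S = {C \<in> \<B>. C \<subseteq> S \<and> (\<forall>B\<in>\<B>. B \<subseteq> S \<longrightarrow> B \<inter> C \<noteq> {} \<longrightarrow> B \<subseteq> C)}"

lemma compsD:
  assumes "C \<in> comps S"
  shows "C \<in> \<B>" "C \<subseteq> S" "\<And>B. B \<in> \<B> \<Longrightarrow> B \<subseteq> S \<Longrightarrow> B \<inter> C \<noteq> {} \<Longrightarrow> B \<subseteq> C"
  using assms unfolding comps_def by auto

lemma comps_disjoint: "C \<in> comps S \<Longrightarrow> C' \<in> comps S \<Longrightarrow> C \<inter> C' \<noteq> {} \<Longrightarrow> C = C'"
  by (metis Int_commute compsD subset_antisym)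

lemma ex_comp:
  assumes "B \<in> \<B>" "B \<subseteq> S"
  obtains C where "C \<in> comps S" "B \<subseteq> C"
proof -
  let ?X = "{C \<in> \<B>. C \<subseteq> S}"
  have "B \<in> ?X" using assms by simp
  then obtain C where C: "C \<in> ?X" "B \<subseteq> C" and max: "\<And>D. D \<in> ?X \<Longrightarrow> C \<subseteq> D \<Longrightarrow> C = D"
    using finite_has_maximal2[of ?X B] by auto
  have "D \<subseteq> C" if "D \<in> \<B>" "D \<subseteq> S" "D \<inter> C \<noteq> {}" for D
    using max[of "D \<union> C"] block_union[of D C] that C by auto
  then have "C \<in> comps S" using C unfolding comps_def by auto
  then show ?thesis using that C(2) by blast
qed

lemma ex_comp_point:
  assumes "s \<in> S" obtains C where "C \<in> comps S" "s \<in> C"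
  using ex_comp[OF block_singleton[of s]] assms by blast

lemma Union_comps: "\<Union>(comps S) = S"
proof
  show "\<Union>(comps S) \<subseteq> S" using compsD(2) by blast
  show "S \<subseteq> \<Union>(comps S)" by (meson UnionI ex_comp_point subsetI)
qed

lemma comps_block:
  assumes "B \<in> \<B>" shows "comps B = {B}"
proof -
  have "B \<in> comps B" using assms unfolding comps_def by auto
  moreover have "C = B" if "C \<in> comps B" for C
    using comps_disjoint[OF that calculation] compsD[OF that] block_nonempty by (metis inf.absorb1)
  ultimately show ?thesis by blast
qed

lemma comps_empty [simp]: "comps {} = {}"
proof -
  have "{} \<notin> \<B>" using block_nonempty by blast
  then show ?thesis unfolding comps_def by auto
qed

lemma comps_antimono:
  assumes "C \<in> comps S" "C \<subseteq> D" "D \<subseteq> S" shows "C \<in> comps D"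
  using assms unfolding comps_def by auto

text \<open>Stated for any commutative monoid: it serves for real sums and, in
  \<open>proj_char_vec_comps\<close>, for sums of vectors.\<close>

lemma sum_comps:
  fixes x :: "'e \<Rightarrow> 'b::comm_monoid_add"
  shows "sum x S = (\<Sum>C\<in>comps S. sum x C)"
proof -
  have "sum x (\<Union>(comps S)) = (\<Sum>C\<in>comps S. sum x C)"
    using comps_disjoint by (subst sum.Union_disjoint) auto
  then show ?thesis by (simp add: Union_comps)
qed

text \<open>The function \<open>g\<close> of the overview.\<close>

definition ghat :: "'e set \<Rightarrow> real" where
  "ghat S = (\<Sum>C\<in>comps S. tri C)"

lemma ghat_block: "B \<in> \<B> \<Longrightarrow> ghat B = tri B"
  by (simp add: ghat_def comps_block)

lemma ghat_empty [simp]: "ghat {} = 0"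
  by (simp add: ghat_def)

text \<open>Spread evenly, \<open>tri C\<close> charges \<open>(card C + 1) / 2\<close> to each
  point of \<open>C\<close>, which is at most the charge \<open>(card S + 1) / 2\<close> made by
  \<open>tri S\<close>.\<close>

lemma ghat_le_tri: "ghat S \<le> tri S"
proof -
  have "ghat S \<le> (\<Sum>C\<in>comps S. \<Sum>s\<in>C. (real (card S) + 1) / 2)"
    unfolding ghat_def
  proof (rule sum_mono)
    fix C assume "C \<in> comps S"
    then have "card C \<le> card S" by (simp add: card_mono compsD(2))
    then show "tri C \<le> (\<Sum>s\<in>C. (real (card S) + 1) / 2)"
      by (simp add: tri_eq divide_right_mono mult_left_mono)
  qed
  also have "\<dots> = (\<Sum>s\<in>S. (real (card S) + 1) / 2)"
    by (rule sum_comps[symmetric])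
  also have "\<dots> = tri S"
    by (simp add: tri_eq)
  finally show ?thesis .
qed

text \<open>The slacks of the components are non-negative and add up to zero.\<close>

lemma comp_tight:
  assumes "\<And>B. B \<in> \<B> \<Longrightarrow> tri B \<le> sum x B" "sum x S = ghat S" "C \<in> comps S"
  shows "sum x C = tri C"
proof -
  have "(\<Sum>C\<in>comps S. sum x C - tri C) = 0"
    using assms(2) by (simp add: sum_subtractf ghat_def sum_comps[of x S])
  then have "\<forall>C\<in>comps S. sum x C - tri C = 0"
    by (subst (asm) sum_nonneg_eq_0_iff) (use assms(1) compsD(1) in auto)
  then show ?thesis using assms(3) by simp
qed

section \<open>Unions of components and the additivity of \<open>ghat\<close>\<close>

text \<open>As components cover \<open>S\<close>, this says that \<open>D\<close> is a union of
  components of \<open>S\<close>.\<close>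

definition saturated :: "'e set \<Rightarrow> 'e set \<Rightarrow> bool" where
  "saturated D S \<longleftrightarrow> D \<subseteq> S \<and> (\<forall>K\<in>comps S. K \<subseteq> D \<or> K \<inter> D = {})"

lemma comps_saturated:
  assumes "saturated D S"
  shows "comps D = {K \<in> comps S. K \<subseteq> D}"
proof -
  have "K \<in> comps S" if K: "K \<in> comps D" for K
  proof -
    have "K \<subseteq> S" using assms compsD(2)[OF K] unfolding saturated_def by auto
    then obtain C where C: "C \<in> comps S" "K \<subseteq> C"
      using ex_comp[OF compsD(1)[OF K]] by blast
    have ne: "K \<noteq> {}" using block_nonempty compsD(1)[OF K] by auto
    then have "C \<subseteq> D"
      using assms C compsD(2)[OF K] unfolding saturated_def by blast
    then have "C \<subseteq> K"
      using compsD(3)[OF K compsD(1)[OF C(1)]] C ne by auto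
    then show ?thesis using C by auto
  qed
  moreover have "K \<subseteq> D" if "K \<in> comps D" for K
    using compsD(2)[OF that] .
  moreover have "K \<in> comps D" if "K \<in> comps S" "K \<subseteq> D" for K
    using comps_antimono[OF that] assms unfolding saturated_def by auto
  ultimately show ?thesis by blast
qed

lemma saturated_Diff:
  assumes "saturated D S" shows "saturated (S - D) S"
  unfolding saturated_def
proof (intro conjI ballI)
  fix K assume "K \<in> comps S"
  then have "K \<subseteq> S" "K \<subseteq> D \<or> K \<inter> D = {}"
    using assms compsD(2) unfolding saturated_def by auto
  then show "K \<subseteq> S - D \<or> K \<inter> (S - D) = {}" by blast
qed blast

lemma saturated_comp:
  assumes "C \<in> comps S" shows "saturated C S"
proof -
  have "K \<subseteq> C \<or> K \<inter> C = {}" if "K \<in> comps S" for K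
    using comps_disjoint[OF that assms] by blast
  then show ?thesis unfolding saturated_def using compsD(2)[OF assms] by simp
qed

text \<open>The conclusion is relative to \<open>D\<close>, so that \<open>ghat_saturated\<close>
  can split \<open>D\<close> in turn.\<close>

lemma saturated_Int:
  assumes "saturated D S" "saturated D' S"
  shows "saturated (D \<inter> D') D"
proof -
  have "K \<subseteq> D \<inter> D' \<or> K \<inter> (D \<inter> D') = {}" if "K \<in> comps D" for K
    using that assms(2) comps_saturated[OF assms(1)] unfolding saturated_def by auto
  then show ?thesis unfolding saturated_def[of "D \<inter> D'"] by simp
qed

lemma ghat_saturated:
  assumes "saturated D S"
  shows "ghat S = ghat D + ghat (S - D)"
proof -
  have "K \<subseteq> D \<or> K \<subseteq> S - D" if "K \<in> comps S" for K
    using that assms compsD(2)[OF that] unfolding saturated_def by blast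
  then have "comps S = comps D \<union> comps (S - D)"
    unfolding comps_saturated[OF assms] comps_saturated[OF saturated_Diff[OF assms]] by auto
  moreover have "comps D \<inter> comps (S - D) = {}"
  proof -
    have False if "K \<in> comps D" "K \<in> comps (S - D)" for K
      using compsD(2)[OF that(1)] compsD(2)[OF that(2)] block_nonempty[OF compsD(1)[OF that(1)]]
      by blast
    then show ?thesis by blast
  qed
  ultimately show ?thesis by (simp add: ghat_def sum.union_disjoint)
qed

text \<open>A component of \<open>R\<close> is still a block inside \<open>insert a R\<close>, so
  \<open>A\<close> absorbs it as soon as it meets it: adding \<open>a\<close> merges whole
  components.\<close>

lemma saturated_insert:
  assumes "A \<in> comps (insert a R)" "a \<in> A" "a \<notin> R"
  shows "saturated (A - {a}) R"
  unfolding saturated_def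
proof (intro conjI ballI)
  show "A - {a} \<subseteq> R" using compsD(2)[OF assms(1)] by auto
  fix K assume K: "K \<in> comps R"
  then have "K \<subseteq> R" "K \<in> \<B>" using compsD by auto
  then show "K \<subseteq> A - {a} \<or> K \<inter> (A - {a}) = {}"
    using compsD(3)[OF assms(1), of K] assms(3) by blast
qed

text \<open>The components of \<open>R\<close> outside \<open>A\<close> are unaffected by adding
  \<open>a\<close>. Hence the increment of \<open>ghat\<close> is
  \<open>tri A - ghat (A - {a})\<close> and depends on \<open>A\<close> alone.\<close>

lemma ghat_marginal:
  assumes "A \<in> comps (insert a R)" "a \<in> A" "a \<notin> R"
  shows "ghat (insert a R) = tri A + ghat (R - A)"
    and "ghat R = ghat (A - {a}) + ghat (R - A)"
proof -
  have *: "insert a R - A = R - A" "R - (A - {a}) = R - A" using assms by auto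
  show "ghat (insert a R) = tri A + ghat (R - A)"
    using ghat_saturated[OF saturated_comp[OF assms(1)]] ghat_block[OF compsD(1)[OF assms(1)]] *
    by simp
  show "ghat R = ghat (A - {a}) + ghat (R - A)"
    using ghat_saturated[OF saturated_insert[OF assms]] * by simp
qed

section \<open>Nested sets from chains\<close>

definition chain_nested :: "'e set set \<Rightarrow> 'e set set" where
  "chain_nested \<S> = (\<Union>S\<in>\<S>. comps S) - {UNIV}"

text \<open>A component of a smaller set of the chain is a block inside the larger ones, which gives
  (N1). For (N2), take the largest set of the chain having a member \<open>C\<close> of
  \<open>T\<close> as a component: if the union of \<open>T\<close> were a block, \<open>C\<close>
  would absorb it, against disjointness.\<close>

lemma nested_chain_nested:
  assumes "chain_subset \<S>"
  shows "nested_set UNIV \<B> (chain_nested \<S>)"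
  unfolding nested_set_def
proof (intro conjI ballI allI impI)
  show "chain_nested \<S> \<subseteq> \<B> - {UNIV}"
    unfolding chain_nested_def using compsD(1) by auto
next
  fix A B assume "A \<in> chain_nested \<S>" "B \<in> chain_nested \<S>"
  then obtain S T where *: "S \<in> \<S>" "T \<in> \<S>" "A \<in> comps S" "B \<in> comps T"
    unfolding chain_nested_def by auto
  have "S \<subseteq> T \<or> T \<subseteq> S" using assms * unfolding chain_subset_def by auto
  then show "A \<subseteq> B \<or> B \<subseteq> A \<or> A \<inter> B = {}"
    using compsD[OF *(3)] compsD[OF *(4)] by (metis Int_commute subset_trans)
next
  fix T assume T: "T \<subseteq> chain_nested \<S> \<and> 2 \<le> card T \<and> disjoint T"
  show "\<Union>T \<notin> \<B>"
  proof
    assume U: "\<Union>T \<in> \<B>"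
    let ?X = "{S \<in> \<S>. \<exists>C\<in>T. C \<in> comps S}"
    have ne: "T \<noteq> {}" using T by auto
    then have "?X \<noteq> {}" using T unfolding chain_nested_def by blast
    then obtain S where S: "S \<in> ?X" and max: "\<And>S'. S' \<in> ?X \<Longrightarrow> S \<subseteq> S' \<Longrightarrow> S = S'"
      using finite_has_maximal[of ?X] by auto
    obtain C where C: "C \<in> T" "C \<in> comps S" using S by auto
    have "D \<subseteq> S" if D: "D \<in> T" for D
    proof -
      obtain S' where S': "S' \<in> \<S>" "D \<in> comps S'"
        using D T unfolding chain_nested_def by blast
      then have "S' \<subseteq> S" using S max[of S'] assms D unfolding chain_subset_def by blast
      then show ?thesis using S' compsD(2) by blast
    qed
    then have "\<Union>T \<subseteq> S" by auto
    moreover have "\<Union>T \<inter> C \<noteq> {}"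
      using C(1) block_nonempty[OF compsD(1)[OF C(2)]] by auto
    ultimately have UC: "\<Union>T \<subseteq> C" by (rule compsD(3)[OF C(2) U])
    have "card {C} < card T" using T by simp
    then obtain D where D: "D \<in> T" "D \<noteq> C" using card_mono[of "{C}" T] by fastforce
    then have "D \<inter> C = {}" using T C by (simp add: disjoint_def)
    moreover have "D \<in> \<B>"
      using D(1) T compsD(1) unfolding chain_nested_def by auto
    then have "D \<noteq> {}" by (rule block_nonempty)
    ultimately show False using UC D by blast
  qed
qed

definition levels :: "('e \<Rightarrow> nat) \<Rightarrow> 'e set set" where
  "levels h = range (\<lambda>t. {s. h s \<le> t})"

lemma chain_levels: "chain_subset (levels h)"
proof -
  have "{s. h s \<le> t} \<subseteq> {s. h s \<le> u} \<or> {s. h s \<le> u} \<subseteq> {s. h s \<le> t}" for t u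
    using linear[of t u] by auto
  then show ?thesis unfolding chain_subset_def levels_def by blast
qed

text \<open>Injectivity of \<open>h\<close> means that the level sets grow by one element at a time.\<close>

lemma maximal_flag:
  assumes "inj h"
  shows "maximal_nested_set UNIV \<B> (chain_nested (levels h))"
  unfolding maximal_nested_set_def
proof (intro conjI allI impI nested_chain_nested chain_levels)
  fix M assume M: "nested_set UNIV \<B> M \<and> chain_nested (levels h) \<subseteq> M"
  have "X \<in> chain_nested (levels h)" if X: "X \<in> M" for X
  proof -
    have XB: "X \<in> \<B>" "X \<noteq> UNIV" using M X unfolding nested_set_def by auto
    have "X \<noteq> {}" using XB block_nonempty by auto
    \<comment> \<open>\<open>x\<close> is the last element of \<open>X\<close> in the order given by
      \<open>h\<close>.\<close>
    then have "Max (h ` X) \<in> h ` X" by (intro Max_in) auto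
    then obtain x where "x \<in> X" "h x = Max (h ` X)" by auto
    then have x: "x \<in> X" "\<And>y. y \<in> X \<Longrightarrow> h y \<le> h x" by auto
    let ?S = "{s. h s \<le> h x}" and ?S' = "{s. h s < h x}"
    obtain D where D: "D \<in> comps ?S" "X \<subseteq> D" using ex_comp[OF XB(1), of ?S] x by auto
    have inS': "comps ?S' \<subseteq> M"
    \<comment> \<open>The strict level set is the level set of the predecessor of
      \<open>h x\<close>; for \<open>h x = 0\<close> it is empty and has no components.\<close>
    proof (cases "h x")
      case 0 then show ?thesis by simp
    next
      case (Suc t)
      then have "?S' = {s. h s \<le> t}" by auto
      then have "?S' \<in> levels h" unfolding levels_def by auto
      moreover have "UNIV \<notin> comps ?S'" using compsD(2) by blast
      ultimately have "comps ?S' \<subseteq> chain_nested (levels h)"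
        unfolding chain_nested_def by auto
      then show ?thesis using M by auto
    qed
    have "X = D"
    proof (rule ccontr)
      assume "X \<noteq> D"
      \<comment> \<open>The block \<open>D\<close> would be the disjoint union of \<open>X\<close>
        and of components of the strict level set, all of them members of \<open>M\<close>, which
        contradicts (N2).\<close>
      define T where "T = {K \<in> comps ?S'. K \<subseteq> D \<and> K \<inter> X = {}}"
      have cover: "\<exists>K\<in>T. y \<in> K" if y: "y \<in> D - X" for y
      proof -
        have "y \<noteq> x" "h y \<le> h x" using y x compsD(2)[OF D(1)] by auto
        then have "h y < h x" using injD[OF assms, of y x] le_neq_implies_less by blast
        then have "y \<in> ?S'" by simp
        then obtain K where K: "K \<in> comps ?S'" "y \<in> K" by (rule ex_comp_point)
        have "K \<subseteq> ?S" using compsD(2)[OF K(1)] by (rule order_trans) auto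
        then have "K \<subseteq> D" using compsD(3)[OF D(1) compsD(1)[OF K(1)]] K(2) y by blast
        moreover have "x \<notin> K" using compsD(2)[OF K(1)] by auto
        moreover have "K \<in> M" using inS' K(1) by auto
        then have "K \<subseteq> X \<or> X \<subseteq> K \<or> K \<inter> X = {}"
          using nested_setD(3)[of UNIV \<B> M K X] M X by simp
        ultimately have "K \<subseteq> D" "K \<inter> X = {}" using K(2) x(1) y by auto
        then show ?thesis using K unfolding T_def by auto
      qed
      have "\<Union>T \<subseteq> D" unfolding T_def by blast
      moreover have "D - X \<subseteq> \<Union>T" using cover by blast
      ultimately have "\<Union>(insert X T) = D" using D(2) by auto
      moreover obtain K where K: "K \<in> T" using cover D(2) \<open>X \<noteq> D\<close> by blast
      then have "K \<noteq> X" using \<open>X \<noteq> {}\<close> unfolding T_def by auto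
      then have "card {X, K} = 2" by simp
      then have "2 \<le> card (insert X T)"
        using card_mono[of "insert X T" "{X, K}"] K by simp
      moreover have "insert X T \<subseteq> M" using X inS' unfolding T_def by auto
      moreover have "disjoint (insert X T)"
        unfolding T_def disjoint_def using comps_disjoint by blast
      ultimately show False
        using nested_setD(4)[of UNIV \<B> M "insert X T"] M compsD(1)[OF D(1)] by metis
    qed
    then show ?thesis using D XB unfolding chain_nested_def levels_def by auto
  qed
  then show "M = chain_nested (levels h)" using M by auto
qed

section \<open>Flips between maximal nested sets\<close>

text \<open>List \<open>C - {a, b}\<close> first, then \<open>a\<close> and \<open>b\<close> in
  either order, then the rest. The two flags differ in a single set, and there every component other
  than \<open>A\<close> or \<open>B\<close> is already a component of
  \<open>C - {a, b}\<close>.\<close>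

lemma exchangeable_comps:
  assumes C: "C \<in> \<B>" and ab: "a \<in> C" "b \<in> C" "a \<noteq> b"
    and A: "A \<in> comps (C - {b})" "a \<in> A" and B: "B \<in> comps (C - {a})" "b \<in> B"
  shows "exchangeable UNIV \<B> A B"
proof -
  obtain e :: "'e \<Rightarrow> nat" and m where "e ` UNIV = {i. i < m}" and e: "inj e"
    using finite_imp_inj_to_nat_seg[of "UNIV :: 'e set"] by auto
  then have em: "e s < m" for s by blast
  define Z where "Z = C - {a, b}"
  \<comment> \<open>The values on \<open>Z\<close> lie below \<open>m\<close>, then come
    \<open>p\<close> at \<open>m\<close> and \<open>q\<close> at \<open>m + 1\<close>, and
    everything outside \<open>C\<close> starts at \<open>m + 2\<close>.\<close>
  define fl where "fl p q s = (if s \<in> Z then e s else if s = p then m else if s = q then m + 1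
    else m + 2 + e s)" for p q s
  let ?L = "\<lambda>p q t. {s. fl p q s \<le> t}"
  have fle: "?L p q t = (if t < m then {s \<in> Z. e s \<le> t} else if t = m then insert p Z
      else C \<union> {s. m + 2 + e s \<le> t})" if "{p, q} = {a, b}" for p q t
  proof -
    have pq: "p \<noteq> q" "p \<notin> Z" "q \<notin> Z" "C = insert p (insert q Z)"
      using that ab unfolding Z_def by (auto simp: doubleton_eq_iff)
    have "fl p q s \<le> t \<longleftrightarrow> s \<in> (if t < m then {s \<in> Z. e s \<le> t} else if t = m then insert p Z
      else C \<union> {s. m + 2 + e s \<le> t})" for s
      using em[of s] pq by (auto simp: fl_def)
    then show ?thesis by blast
  qed
  have Lm: "?L a b m = C - {b}" "?L b a m = C - {a}"
    using fle[of a b m, OF refl] fle[of b a m, OF insert_commute] ab unfolding Z_def by auto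
  have other: "?L a b t = ?L b a t" "?L a b t \<subseteq> Z \<or> C \<subseteq> ?L a b t" if "t \<noteq> m" for t
    using fle[of a b t, OF refl] fle[of b a t, OF insert_commute] that by auto
  define X where "X = (\<Union>t\<in>-{m}. comps (?L a b t)) - {UNIV}"
  have UNm: "(\<Union>t. F t) = (\<Union>t\<in>-{m}. F t) \<union> F m" for F :: "nat \<Rightarrow> 'e set set"
    by blast
  have split: "chain_nested (levels (fl p q)) = (X \<union> comps (?L p q m)) - {UNIV}"
    if "{p, q} = {a, b}" for p q
  proof -
    have "?L p q t = ?L a b t" if "t \<noteq> m" for t
      using other[OF that] \<open>{p, q} = {a, b}\<close> by (auto simp: doubleton_eq_iff)
    then have "(\<Union>t\<in>-{m}. comps (?L a b t)) = (\<Union>t\<in>-{m}. comps (?L p q t))" by simp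
    moreover have "(\<Union>t. comps (?L p q t)) = (\<Union>t\<in>-{m}. comps (?L p q t)) \<union> comps (?L p q m)"
      by (rule UNm)
    ultimately show ?thesis unfolding chain_nested_def levels_def X_def
      by (simp add: image_image Un_Diff)
  qed
  \<comment> \<open>A component of a level other than \<open>m\<close> lies in \<open>Z\<close>, or
    else the level contains \<open>C\<close> and the component absorbs \<open>C\<close> once it
    meets it. So neither \<open>A\<close> nor \<open>B\<close> is in the common part
    \<open>X\<close>.\<close>
  have sep: "D \<notin> X" if "D \<in> \<B>" "\<not> C \<subseteq> D" "\<not> D \<subseteq> Z" "D \<inter> C \<noteq> {}" for D
  proof
    assume "D \<in> X"
    then obtain t where t: "t \<noteq> m" "D \<in> comps (?L a b t)" unfolding X_def by auto
    then show False using other(2)[OF t(1)] compsD[OF t(2)] that C by blast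
  qed
  have AC: "A \<in> \<B>" "A \<subseteq> C - {b}" "B \<in> \<B>" "B \<subseteq> C - {a}" using A B compsD by blast+
  have XA: "A \<notin> X" "B \<notin> X"
    by (rule sep; use AC A(2) B(2) ab in \<open>auto simp: Z_def\<close>)+
  have inj: "inj (fl p q)" if "{p, q} = {a, b}" for p q
  proof (rule injI)
    fix s s' assume "fl p q s = fl p q s'"
    then show "s = s'" using em[of s] em[of s'] e unfolding fl_def
      by (auto split: if_splits dest: injD)
  qed
  \<comment> \<open>\<open>Z\<close> itself is a level common to both orders; \<open>m > 0\<close>
    makes the subtraction genuine.\<close>
  have Z_level: "?L a b (m - 1) = Z" "m - 1 \<noteq> m"
  proof -
    have m: "m > 0" using em[of a] by simp
    then have "e s \<le> m - 1" for s using em[of s] by simp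
    then show "?L a b (m - 1) = Z" using fle[of a b "m - 1", OF refl] m by simp
    show "m - 1 \<noteq> m" using m by simp
  qed
  have inX: "D \<in> X" if "D \<in> comps Z" for D
  proof -
    have "D \<in> comps (?L a b (m - 1))" using that Z_level by simp
    moreover have "D \<noteq> UNIV" using compsD(2)[OF that] unfolding Z_def by auto
    ultimately show ?thesis using Z_level(2) unfolding X_def by blast
  qed
  have subA: "D \<in> X" if D: "D \<in> comps (C - {b})" "D \<noteq> A" for D
    using comps_antimono[OF D(1), of Z] compsD(2)[OF D(1)] comps_disjoint[OF A(1) D(1)] A(2) D(2)
    unfolding Z_def by (intro inX) (auto simp: Z_def)
  have subB: "D \<in> X" if D: "D \<in> comps (C - {a})" "D \<noteq> B" for D
    using comps_antimono[OF D(1), of Z] compsD(2)[OF D(1)] comps_disjoint[OF B(1) D(1)] B(2) D(2)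
    unfolding Z_def by (intro inX) (auto simp: Z_def)
  have nU: "A \<noteq> UNIV" "B \<noteq> UNIV" "UNIV \<notin> X" using AC unfolding X_def by auto
  have M: "chain_nested (levels (fl a b)) = insert A X"
    using split[of a b] subA A(1) nU Lm by auto
  have M': "chain_nested (levels (fl b a)) = insert B X"
    using split[of b a] subB B(1) nU Lm by (auto simp: insert_commute)
  have "maximal_nested_set UNIV \<B> (insert A X)" "maximal_nested_set UNIV \<B> (insert B X)"
    using maximal_flag[OF inj, of a b] maximal_flag[OF inj, of b a] M M'
    by (auto simp: insert_commute)
  then show ?thesis
    unfolding exchangeable_def using XA
    by (intro exI[of _ "insert A X"] exI[of _ "insert B X"]) simp
qed

section \<open>Covering by nested sets and decomposition along chains\<close>

text \<open>In a minimal subfamily covering \<open>X\<close> the members are incomparable, hence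
  disjoint, and all meet \<open>X\<close>. Joining them to \<open>X\<close> one by one shows that
  their union is a block, so (N2) leaves only one member.\<close>

lemma nested_cover:
  assumes N: "nested_set UNIV \<B> N" and S: "S \<subseteq> insert UNIV N" and X: "X \<in> \<B>" "X \<subseteq> \<Union>S"
  obtains A where "A \<in> S" "X \<subseteq> A"
proof (cases "UNIV \<in> S")
  case True
  then show ?thesis using that by blast
next
  case False
  then have SN: "S \<subseteq> N" using S by auto
  let ?C = "{T. T \<subseteq> S \<and> X \<subseteq> \<Union>T}"
  have "S \<in> ?C" using X by auto
  then obtain T where T: "T \<subseteq> S" "X \<subseteq> \<Union>T" and min: "\<And>T'. T' \<in> ?C \<Longrightarrow> T' \<subseteq> T \<Longrightarrow> T = T'"
    using finite_has_minimal2[of ?C S] by auto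
  have drop: "\<not> X \<subseteq> \<Union>(T - {A})" if "A \<in> T" for A
    using min[of "T - {A}"] T that by auto
  have meet: "X \<inter> A \<noteq> {}" if "A \<in> T" for A
    using drop[OF that] T(2) by auto
  have "A \<inter> B = {}" if AB: "A \<in> T" "B \<in> T" "A \<noteq> B" for A B
  proof -
    have "\<not> A \<subseteq> B" "\<not> B \<subseteq> A" using drop[OF AB(1)] drop[OF AB(2)] T(2) AB by blast+
    then show ?thesis using nested_setD(3)[OF N, of A B] AB T SN by auto
  qed
  then have disj: "disjoint T" by (simp add: disjoint_def)
  have "X \<union> \<Union>F \<in> \<B>" if "F \<subseteq> T" for F
    using finite[of F] that
  proof (induction F rule: finite_induct)
    case empty
    then show ?case using X by simp
  next
    case (insert A F)
    have "A \<in> \<B>" using insert.prems T SN nested_setD(1)[OF N] by auto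
    moreover have "(X \<union> \<Union>F) \<inter> A \<noteq> {}" using meet[of A] insert.prems by auto
    ultimately have "(X \<union> \<Union>F) \<union> A \<in> \<B>" using insert block_union by auto
    then show ?case by (simp add: Un_ac)
  qed
  from this[of T] have "\<Union>T \<in> \<B>" using T(2) by (simp add: Un_absorb1)
  then have "\<not> 2 \<le> card T" using nested_setD(4)[OF N, of T] T SN disj by auto
  moreover have "T \<noteq> {}" using block_nonempty[OF X(1)] T(2) by auto
  then have "card T \<noteq> 0" by simp
  ultimately have "card T = 1" by linarith
  then obtain A where "T = {A}" by (rule card_1_singletonE)
  then show ?thesis using that T by auto
qed

text \<open>The layer-cake decomposition: peel the smallest positive value off the support and
  recurse on the strictly smaller support.\<close>

lemma ex_chain_decomp:
  fixes c :: "'e \<Rightarrow> real"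
  assumes "\<And>s. c s \<ge> 0"
  obtains \<S> \<mu> where "chain_subset \<S>"
    "\<And>S. \<mu> S \<ge> 0" "\<And>s. c s = (\<Sum>S\<in>\<S>. if s \<in> S then \<mu> S else 0)"
proof -
  \<comment> \<open>Confining the chain to the support is added for the induction: it places the new
    set \<open>S\<close> strictly above the earlier ones.\<close>
  have "\<exists>\<S> \<mu>. chain_subset \<S> \<and> (\<forall>S\<in>\<S>. S \<subseteq> {s. c s > 0}) \<and> (\<forall>S. \<mu> S \<ge> 0) \<and>
      (\<forall>s. c s = (\<Sum>S\<in>\<S>. if s \<in> S then \<mu> S else 0))"
    using assms
  proof (induction "card {s. c s > 0}" arbitrary: c rule: less_induct)
    case less
    show ?case
    proof (cases "{s. c s > 0} = {}")
      case True
      then have "c s = 0" for s using less.prems[of s] by (metis empty_iff mem_Collect_eq order_less_le)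
      then show ?thesis by (intro exI[of _ "{}"] exI[of _ "\<lambda>_. 0"]) (simp add: chain_subset_def)
    next
      case False
      define S where "S = {s. c s > 0}"
      define m where "m = Min (c ` S)"
      have "m \<in> c ` S" unfolding m_def using False by (intro Min_in) (auto simp: S_def)
      then obtain s0 where s0: "s0 \<in> S" "c s0 = m" by auto
      have m: "m > 0" using s0 by (auto simp: S_def)
      have le: "m \<le> c s" if "s \<in> S" for s unfolding m_def using that by simp
      define c' where "c' s = (if s \<in> S then c s - m else 0)" for s
      have nn: "c' s \<ge> 0" for s using le by (simp add: c'_def)
      have sub: "{s. c' s > 0} \<subset> S" using s0 unfolding c'_def by (auto split: if_splits)
      then have "card {s. c' s > 0} < card {s. c s > 0}"
        unfolding S_def by (intro psubset_card_mono) auto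
      from less.hyps[OF this nn] obtain \<S> \<mu> where IH: "chain_subset \<S>"
        "\<forall>T\<in>\<S>. T \<subseteq> {s. c' s > 0}" "\<forall>T. \<mu> T \<ge> 0"
        "\<forall>s. c' s = (\<Sum>T\<in>\<S>. if s \<in> T then \<mu> T else 0)" by blast
      have TS: "T \<subset> S" if "T \<in> \<S>" for T using IH(2) that sub by blast
      then have nS: "S \<notin> \<S>" by blast
      have "c s = (\<Sum>T\<in>insert S \<S>. if s \<in> T then (\<mu>(S := m)) T else 0)" for s
      proof -
        have "(\<Sum>T\<in>\<S>. if s \<in> T then (\<mu>(S := m)) T else 0) = c' s"
          unfolding IH(4)[rule_format] using nS by (intro sum.cong) auto
        moreover have "c s = 0" if "s \<notin> S" using that less.prems[of s] by (simp add: S_def)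
        ultimately show ?thesis using nS by (simp add: c'_def)
      qed
      moreover have "chain_subset (insert S \<S>)"
        using IH(1) TS unfolding chain_subset_def by blast
      moreover have "\<forall>T. (\<mu>(S := m)) T \<ge> 0" using IH(3) m by simp
      moreover have "\<forall>T\<in>insert S \<S>. T \<subseteq> {s. c s > 0}" using TS S_def by blast
      ultimately show ?thesis by blast
    qed
  qed
  then show ?thesis using that by blast
qed

end

section \<open>Supermodularity of the component sums\<close>

locale exchange_closed_building = connected_building \<B> for \<B> :: "'e::finite set set" +
  assumes exch: "\<And>B B'. B \<in> \<B> \<Longrightarrow> B' \<in> \<B> \<Longrightarrow> exchangeable UNIV \<B> B B' \<Longrightarrow> B \<inter> B' \<in> \<B> \<union> {{}}"
begin

text \<open>The heart of the argument, and where the condition on exchangeable blocks enters: it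
  gives \<open>ghat (A \<inter> B) = tri (A \<inter> B)\<close>. Cutting along components then
  reduces the claim to an inequality between triangular numbers.\<close>

lemma ghat_block_strict:
  assumes C: "C \<in> \<B>" and ab: "a \<in> C" "b \<in> C" "a \<noteq> b"
  shows "ghat (C - {a}) + ghat (C - {b}) < tri C + ghat (C - {a, b})"
proof -
  define Z where "Z = C - {a, b}"
  have ins: "insert a Z = C - {b}" "insert b Z = C - {a}" "a \<notin> Z" "b \<notin> Z"
    using ab unfolding Z_def by auto
  obtain A where A: "A \<in> comps (insert a Z)" "a \<in> A" by (rule ex_comp_point[of a "insert a Z"]) auto
  obtain B where B: "B \<in> comps (insert b Z)" "b \<in> B" by (rule ex_comp_point[of b "insert b Z"]) auto
  have "exchangeable UNIV \<B> A B"
    using exchangeable_comps[OF C ab] A B ins by auto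
  then have "A \<inter> B \<in> \<B> \<union> {{}}" using exch A B compsD(1) by auto
  then have AB: "ghat (A \<inter> B) = tri (A \<inter> B)" using ghat_block by auto
  have sub: "A \<subseteq> insert a Z" "B \<subseteq> insert b Z" using A B compsD(2) by auto
  define A' where "A' = A - {a}" define B' where "B' = B - {b}"
  have sat: "saturated A' Z" "saturated B' Z"
    unfolding A'_def B'_def using saturated_insert A B ins by auto
  define W where "W = Z - B - A"
  have 1: "ghat (C - {b}) = tri A + ghat (Z - A)" "ghat Z = ghat A' + ghat (Z - A)"
    using ghat_marginal[OF A ins(3)] ins unfolding A'_def by auto
  have 2: "ghat (C - {a}) = tri B + ghat (Z - B)"
    using ghat_marginal(1)[OF B ins(4)] ins by auto
  have "A' \<inter> B' = A \<inter> B" "A' - A' \<inter> B' = A' - B'"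
    unfolding A'_def B'_def using sub ins by auto
  then have 3: "ghat A' = ghat (A \<inter> B) + ghat (A' - B')"
    using ghat_saturated[OF saturated_Int[OF sat]] by simp
  \<comment> \<open>The set \<open>Z - B\<close>, a union of components of \<open>Z\<close>, is cut
    by \<open>A'\<close>; the resulting \<open>ghat (A' - B')\<close> cancels against the one in
    fact \<open>3\<close>.\<close>
  have "Z - B' = Z - B" "(Z - B) \<inter> A' = A' - B'" "Z - B - (A' - B') = W"
    unfolding A'_def B'_def W_def using sub ins by auto
  then have 4: "ghat (Z - B) = ghat (A' - B') + ghat W"
    using ghat_saturated[OF saturated_Int[OF saturated_Diff[OF sat(2)] sat(1)]] by simp
  define p where "p = real (card (A \<inter> B))"
  define \<alpha> where "\<alpha> = real (card (A - B))"
  define \<beta> where "\<beta> = real (card (B - A))"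
  define w where "w = real (card W)"
  have ABC: "A \<subseteq> C" "B \<subseteq> C" using sub ab unfolding Z_def by auto
  have disj: "C = (A \<inter> B) \<union> (A - B) \<union> (B - A) \<union> W"
    using ABC A(2) B(2) unfolding W_def Z_def by auto
  have "a \<in> A - B" "b \<in> B - A" using A B sub ins ab by auto
  then have pos: "\<alpha> > 0" "\<beta> > 0" unfolding \<alpha>_def \<beta>_def by (auto simp: card_gt_0_iff)
  have "card A = card (A \<inter> B) + card (A - B)" "card B = card (A \<inter> B) + card (B - A)"
    by (subst card_Un_disjoint[symmetric]; auto intro!: arg_cong[of _ _ card])+
  moreover have "card C = card (A \<inter> B) + card (A - B) + card (B - A) + card W"
    unfolding disj W_def by (subst card_Un_disjoint; auto)+
  ultimately have cards: "real (card A) = p + \<alpha>" "real (card B) = p + \<beta>"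
    "real (card C) = p + \<alpha> + \<beta> + w"
    unfolding p_def \<alpha>_def \<beta>_def w_def by simp_all
  \<comment> \<open>This quantity is exactly
    \<open>tri C + tri (A \<inter> B) - tri A - tri B - tri W\<close>.\<close>
  have "0 < \<alpha> * \<beta> + w * (p + \<alpha> + \<beta>)"
    using pos by (intro add_pos_nonneg) (auto simp: w_def p_def)
  then have "tri A + tri B + tri W < tri C + tri (A \<inter> B)"
    unfolding tri_eq cards p_def[symmetric] w_def[symmetric] by (simp add: field_simps)
  then show ?thesis
    using 1 2 3 4 AB ghat_le_tri[of W] unfolding Z_def by simp
qed

text \<open>By \<open>ghat_marginal\<close> only the components of \<open>a\<close> matter. If
  \<open>b\<close> is not in the larger one, \<open>C\<close>, both increments agree; otherwise the
  smaller one is the component of \<open>a\<close> in \<open>C - {b}\<close> and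
  \<open>ghat_block_strict\<close> applies.\<close>

lemma ghat_local:
  assumes ab: "a \<noteq> b" "a \<notin> R" "b \<notin> R"
  shows "ghat (insert a R) - ghat R \<le> ghat (insert a (insert b R)) - ghat (insert b R)"
proof -
  define S where "S = insert a (insert b R)"
  obtain C where C: "C \<in> comps S" "a \<in> C" by (rule ex_comp_point[of a S]) (auto simp: S_def)
  have CB: "C \<in> \<B>" "C \<subseteq> S" using compsD[OF C(1)] by auto
  have up: "ghat S - ghat (insert b R) = tri C - ghat (C - {a})"
    using ghat_marginal[of C a "insert b R"] C ab unfolding S_def by simp
  show ?thesis
  proof (cases "b \<in> C")
    case False
    then have "C \<in> comps (insert a R)"
      using comps_antimono[OF C(1), of "insert a R"] CB(2) unfolding S_def by auto
    then show ?thesis using ghat_marginal[of C a R] C ab up unfolding S_def by simp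
  next
    case True
    obtain A where A: "A \<in> comps (insert a R)" "a \<in> A"
      by (rule ex_comp_point[of a "insert a R"]) auto
    have AB: "A \<in> \<B>" "A \<subseteq> insert a R" using compsD[OF A(1)] by auto
    have "A \<subseteq> C" using compsD(3)[OF C(1) AB(1)] AB(2) A(2) C(2) unfolding S_def by auto
    moreover have "b \<notin> A" using AB ab by auto
    ultimately have "A \<in> comps (insert a (C - {a, b}))"
      using comps_antimono[OF A(1), of "insert a (C - {a, b})"] CB(2) unfolding S_def by auto
    moreover have "insert a (C - {a, b}) = C - {b}" using C ab by auto
    ultimately have "ghat (C - {b}) - ghat (C - {a, b}) = tri A - ghat (A - {a})"
      using ghat_marginal[of A a "C - {a, b}"] A by simp
    moreover have "ghat (insert a R) - ghat R = tri A - ghat (A - {a})"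
      using ghat_marginal[OF A ab(2)] by simp
    ultimately show ?thesis
      using ghat_block_strict[OF CB(1) C(2) True ab(1)] up unfolding S_def by simp
  qed
qed

lemma ghat_marginal_mono:
  assumes "R \<subseteq> Q" "a \<notin> Q"
  shows "ghat (insert a R) - ghat R \<le> ghat (insert a Q) - ghat Q"
proof -
  have "finite (Q - R)" by simp
  then show ?thesis using assms
  proof (induction "Q - R" arbitrary: Q rule: finite_induct)
    case empty
    then have "Q = R" by auto
    then show ?case by simp
  next
    case (insert b F)
    let ?Q = "Q - {b}"
    have Q: "insert b ?Q = Q" "b \<notin> ?Q" "a \<notin> ?Q" "a \<noteq> b" using insert by auto
    have "F = ?Q - R" using insert by auto
    moreover have "R \<subseteq> ?Q" using insert by auto
    ultimately have "ghat (insert a R) - ghat R \<le> ghat (insert a ?Q) - ghat ?Q"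
      using insert.hyps(3)[of ?Q] Q by auto
    also have "\<dots> \<le> ghat (insert a Q) - ghat Q"
      using ghat_local[of a b ?Q] Q by (simp add: insert_commute)
    finally show ?case .
  qed
qed

text \<open>Weak monotonicity leads up to \<open>Q - {b}\<close>; the last step is strict because
  \<open>insert a Q\<close> is a block.\<close>

lemma ghat_marginal_strict:
  assumes "R \<subset> Q" "a \<notin> Q" "insert a Q \<in> \<B>"
  shows "ghat (insert a R) - ghat R < ghat (insert a Q) - ghat Q"
proof -
  obtain b where b: "b \<in> Q" "b \<notin> R" using assms by auto
  let ?Q = "Q - {b}"
  have ne: "a \<noteq> b" using assms b by auto
  have eq: "insert a Q - {a} = Q" "insert a Q - {b} = insert a ?Q" "insert a Q - {a, b} = ?Q"
    using assms b ne by auto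
  have "ghat (insert a R) - ghat R \<le> ghat (insert a ?Q) - ghat ?Q"
    using assms b by (intro ghat_marginal_mono) auto
  also have "\<dots> < ghat (insert a Q) - ghat Q"
    using ghat_block_strict[of "insert a Q" a b] assms b ne ghat_block[of "insert a Q"]
    unfolding eq by simp
  finally show ?thesis .
qed

lemma ghat_supermodular: "ghat S + ghat T \<le> ghat (S \<union> T) + ghat (S \<inter> T)"
proof -
  have "ghat (S \<inter> T \<union> Y) - ghat (S \<inter> T) \<le> ghat (T \<union> Y) - ghat T" if "Y \<inter> T = {}" for Y
    using finite[of Y] that
  proof (induction Y rule: finite_induct)
    case (insert a Y)
    have "ghat (insert a (S \<inter> T \<union> Y)) - ghat (S \<inter> T \<union> Y)
        \<le> ghat (insert a (T \<union> Y)) - ghat (T \<union> Y)"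
      using insert by (intro ghat_marginal_mono) auto
    then show ?case using insert by simp
  qed simp
  moreover have "S \<inter> T \<union> (S - T) = S" "T \<union> (S - T) = S \<union> T" "(S - T) \<inter> T = {}" by auto
  ultimately show ?thesis by (smt (verit))
qed

text \<open>One element \<open>a\<close> of \<open>S - T\<close> contributes strictly less over
  \<open>S - {a}\<close> than over its union with \<open>T\<close>; weak supermodularity handles the
  rest.\<close>

lemma ghat_supermodular_strict:
  assumes "\<not> S \<subseteq> T" "\<not> T \<subseteq> S" "S \<union> T \<in> \<B>"
  shows "ghat S + ghat T < ghat (S \<union> T) + ghat (S \<inter> T)"
proof -
  obtain a where a: "a \<in> S" "a \<notin> T" using assms by auto
  let ?S = "S - {a}"
  have eq: "?S \<inter> T = S \<inter> T" "insert a (?S \<union> T) = S \<union> T" "insert a ?S = S" using a by auto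
  have "ghat (insert a ?S) - ghat ?S < ghat (insert a (?S \<union> T)) - ghat (?S \<union> T)"
    using assms a by (intro ghat_marginal_strict) (auto simp: insert_absorb eq)
  then show ?thesis using ghat_supermodular[of ?S T] unfolding eq by simp
qed

section \<open>Greedy points of the removahedron\<close>

text \<open>Adding elements by increasing \<open>h\<close>, each coordinate is the increment of
  \<open>ghat\<close>. The increments telescope on level sets, and their monotonicity gives the
  lower bounds on all other sets.\<close>

lemma greedy_point:
  fixes h :: "'e \<Rightarrow> nat"
  obtains x :: "'e \<Rightarrow> real" where "\<And>S. ghat S \<le> sum x S"
    "\<And>t. sum x {s. h s \<le> t} = ghat {s. h s \<le> t}"
    "sum x UNIV = ghat UNIV"
proof -
  have "\<exists>x::'e \<Rightarrow> real. (\<forall>S\<subseteq>A. ghat S \<le> sum x S) \<and> sum x A = ghat A \<and>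
      (\<forall>t. sum x {s\<in>A. h s \<le> t} = ghat {s\<in>A. h s \<le> t})" for A
    using finite[of A]
  proof (induction A rule: finite_ranking_induct[where f = h])
    case empty
    show ?case by (simp add: subset_empty)
  next
    case (insert a A)
    show ?case
    proof (cases "a \<in> A")
      case True
      then show ?thesis using insert by (simp add: insert_absorb)
    next
      case False
      obtain x where x: "\<And>S. S \<subseteq> A \<Longrightarrow> ghat S \<le> sum x S" "sum x A = ghat A"
        "\<And>t. sum x {s\<in>A. h s \<le> t} = ghat {s\<in>A. h s \<le> t}" using insert.IH by blast
      define y where "y = x(a := ghat (insert a A) - ghat A)"
      have yx: "sum y S = sum x S" if "a \<notin> S" for S
        unfolding y_def using that by (intro sum.cong) auto
      have yA: "sum y (insert a A) = ghat (insert a A)"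
        using yx[OF False] x(2) False by (simp add: y_def)
      have "ghat S \<le> sum y S" if S: "S \<subseteq> insert a A" for S
      proof (cases "a \<in> S")
        case True
        let ?S = "S - {a}"
        have "insert a ?S = S" "?S \<subseteq> A" using S True by auto
        then have "sum y S = y a + sum x ?S"
          using sum.insert[of ?S a y] yx[of ?S] by auto
        moreover have "ghat S - ghat ?S \<le> ghat (insert a A) - ghat A"
          using ghat_marginal_mono[OF \<open>?S \<subseteq> A\<close> False] \<open>insert a ?S = S\<close> by simp
        ultimately show ?thesis using x(1)[OF \<open>?S \<subseteq> A\<close>] by (simp add: y_def)
      next
        case False
        then show ?thesis using x(1)[of S] yx S by auto
      qed
      moreover have "sum y {s \<in> insert a A. h s \<le> t} = ghat {s \<in> insert a A. h s \<le> t}" for t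
      proof (cases "h a \<le> t")
        case True
        \<comment> \<open>The new element has the largest rank so far, so a level that reaches it
          contains everything.\<close>
        then have "{s \<in> insert a A. h s \<le> t} = insert a A"
          using insert.hyps by force
        then show ?thesis using yA by simp
      next
        case h: False
        then have "{s \<in> insert a A. h s \<le> t} = {s \<in> A. h s \<le> t}" by auto
        then show ?thesis using x(3) yx[of "{s \<in> A. h s \<le> t}"] False by simp
      qed
      ultimately show ?thesis using yA by blast
    qed
  qed
  from this[of UNIV] show ?thesis using that by auto
qed

text \<open>Adjoining \<open>UNIV\<close> ensures that every element enters some level.\<close>

definition level :: "'e set set \<Rightarrow> nat \<Rightarrow> 'e set" where
  "level N t = \<Union>{A \<in> insert UNIV N. card A \<le> t}"

text \<open>Ordering by cardinality makes each \<open>A\<close> in \<open>N\<close> a component of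
  \<open>level N (card A)\<close>: a block meeting \<open>A\<close> there joins with
  \<open>A\<close> to a block that \<open>nested_cover\<close> puts inside one member no larger than
  \<open>A\<close>, that is, \<open>A\<close> itself. The clause on \<open>b\<close> prepares
  \<open>nested_slack\<close>.\<close>

lemma nested_greedy:
  assumes N: "nested_set UNIV \<B> N"
  shows "\<exists>x :: 'e \<Rightarrow> real. (\<forall>S. ghat S \<le> sum x S) \<and> sum x UNIV = tri (UNIV :: 'e set) \<and>
    (\<forall>A\<in>N. sum x A = tri A) \<and> (\<forall>t. sum x (level N t) = ghat (level N t)) \<and>
    (\<forall>t. (\<forall>A\<in>insert UNIV N. b \<in> A \<longrightarrow> t \<le> card A) \<longrightarrow>
      sum x (level N t - {b}) = ghat (level N t - {b}))"
proof -
  let ?L = "level N"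
  define k where "k s = Min (card ` {A \<in> insert UNIV N. s \<in> A})" for s
  have k: "k s \<le> t \<longleftrightarrow> s \<in> ?L t" for s t
    unfolding k_def level_def by (subst Min_le_iff) auto
  \<comment> \<open>The level sets of \<open>k\<close> are the sets \<open>level N t\<close>; doubling leaves room to put \<open>b\<close> last in its level.\<close>
  define h where "h s = 2 * k s + (if s = b then 1 else 0)" for s
  obtain x where x: "\<And>S. ghat S \<le> sum x S" "\<And>t. sum x {s. h s \<le> t} = ghat {s. h s \<le> t}"
    "sum x UNIV = ghat UNIV" using greedy_point[of h] by blast
  have "h s \<le> 2 * t + 1 \<longleftrightarrow> k s \<le> t" for s t unfolding h_def by auto
  then have "{s. h s \<le> 2 * t + 1} = ?L t" for t using k by auto
  then have Lt: "sum x (?L t) = ghat (?L t)" for t using x(2)[of "2 * t + 1"] by simp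
  have Lb: "sum x (?L t - {b}) = ghat (?L t - {b})"
    if "\<forall>A\<in>insert UNIV N. b \<in> A \<longrightarrow> t \<le> card A" for t
  proof -
    have "t \<le> k b" unfolding k_def using that by (subst Min_ge_iff) auto
    then have "h s \<le> 2 * t \<longleftrightarrow> s \<in> ?L t - {b}" for s
      using k[of s t] unfolding h_def by auto
    then have "{s. h s \<le> 2 * t} = ?L t - {b}" by blast
    then show ?thesis using x(2)[of "2 * t"] by simp
  qed
  have tri_le: "tri B \<le> sum x B" if "B \<in> \<B>" for B
    using x(1)[of B] ghat_block[OF that] by simp
  have "sum x A = tri A" if A: "A \<in> N" for A
  proof (rule comp_tight[OF tri_le Lt])
    have AB: "A \<in> \<B>" using A nested_setD(1)[OF N] by auto
    show "A \<in> comps (?L (card A))"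
      unfolding comps_def
    proof (intro CollectI conjI ballI impI AB)
      show AL: "A \<subseteq> ?L (card A)" using A unfolding level_def by auto
      fix B assume B: "B \<in> \<B>" "B \<subseteq> ?L (card A)" "B \<inter> A \<noteq> {}"
      then have "B \<union> A \<in> \<B>" using AB block_union by auto
      then obtain D where D: "D \<in> {A' \<in> insert UNIV N. card A' \<le> card A}" "B \<union> A \<subseteq> D"
        using nested_cover[OF N, of "{A' \<in> insert UNIV N. card A' \<le> card A}" "B \<union> A"] B AL
        unfolding level_def by auto
      then have "A = D" by (intro card_seteq) auto
      then show "B \<subseteq> A" using D by auto
    qed
  qed
  then show ?thesis
    using x(1,3) ghat_block[OF block_UNIV] Lt Lb by (intro exI[of _ x]) simp
qed

text \<open>Let \<open>D\<close> be the smallest member of \<open>insert UNIV N\<close> containing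
  \<open>B\<close>. By \<open>nested_cover\<close> some \<open>b\<close> in \<open>B\<close> lies in
  no member smaller than \<open>D\<close>; putting this \<open>b\<close> last in its level makes its
  coordinate large enough to leave \<open>B\<close> slack.\<close>

lemma nested_slack:
  assumes N: "nested_set UNIV \<B> N" and B: "B \<in> \<B>" "B \<noteq> UNIV" "B \<notin> N"
  obtains x :: "'e \<Rightarrow> real" where "\<And>S. ghat S \<le> sum x S" "sum x UNIV = tri (UNIV :: 'e set)"
    "\<And>A. A \<in> N \<Longrightarrow> sum x A = tri A" "tri B < sum x B"
proof -
  have "UNIV \<in> insert UNIV N \<and> B \<subseteq> UNIV" by simp
  from ex_has_least_nat[of "\<lambda>A. A \<in> insert UNIV N \<and> B \<subseteq> A", OF this, of card]
  obtain D where "(D \<in> insert UNIV N \<and> B \<subseteq> D) \<and>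
      (\<forall>A. A \<in> insert UNIV N \<and> B \<subseteq> A \<longrightarrow> card D \<le> card A)" by (rule exE)
  then have D: "D \<in> insert UNIV N" "B \<subseteq> D"
    and min: "\<And>A. A \<in> insert UNIV N \<Longrightarrow> B \<subseteq> A \<Longrightarrow> card D \<le> card A"
    by simp_all
  have DB: "D \<in> \<B>" using D(1) nested_setD(1)[OF N] block_UNIV by auto
  have "\<not> B \<subseteq> \<Union>{A \<in> insert UNIV N. card A < card D}"
  proof
    assume cov: "B \<subseteq> \<Union>{A \<in> insert UNIV N. card A < card D}"
    have "{A \<in> insert UNIV N. card A < card D} \<subseteq> insert UNIV N" by blast
    from nested_cover[OF N this B(1) cov]
    obtain A where "A \<in> {A \<in> insert UNIV N. card A < card D}" "B \<subseteq> A" .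
    then show False using min[of A] by auto
  qed
  then obtain b where b: "b \<in> B" "b \<notin> \<Union>{A \<in> insert UNIV N. card A < card D}"
    by blast
  have bmin: "\<forall>A\<in>insert UNIV N. b \<in> A \<longrightarrow> card D \<le> card A"
  proof (intro ballI impI)
    fix A assume "A \<in> insert UNIV N" "b \<in> A"
    then have "\<not> card A < card D" using b(2) by blast
    then show "card D \<le> card A" by simp
  qed
  obtain x :: "'e \<Rightarrow> real" where x: "\<forall>S. ghat S \<le> sum x S" "sum x UNIV = tri (UNIV :: 'e set)"
    "\<forall>A\<in>N. sum x A = tri A" "\<forall>t. sum x (level N t) = ghat (level N t)"
    "\<forall>t. (\<forall>A\<in>insert UNIV N. b \<in> A \<longrightarrow> t \<le> card A) \<longrightarrow>
      sum x (level N t - {b}) = ghat (level N t - {b})"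
    using nested_greedy[OF N, of b] by (elim exE conjE) (rule that)
  define L where "L = level N (card D)"
  \<comment> \<open>\<open>D\<close>, \<open>L\<close> and \<open>L - {b}\<close> are tight, hence so is \<open>D - {b}\<close>. As \<open>(D - {b}) \<union> B = D\<close> is a block, strict
    supermodularity prevents \<open>B\<close> from being tight too.\<close>
  have DL: "D \<subseteq> L" unfolding L_def level_def using D(1) by auto
  have bD: "b \<in> D" "b \<in> L" using b D DL by auto
  have tight: "sum x L = ghat L" "sum x (L - {b}) = ghat (L - {b})" "sum x D = ghat D"
    using x(4) x(5)[rule_format, of "card D"] bmin x(2,3) D(1) ghat_block[OF DB]
    unfolding L_def by auto
  have rm: "sum x S = x b + sum x (S - {b})" if "b \<in> S" for S
    using that by (simp add: sum.remove)
  have "D \<union> (L - {b}) = L" "D \<inter> (L - {b}) = D - {b}" using DL bD by auto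
  then have 1: "ghat D + ghat (L - {b}) \<le> ghat L + ghat (D - {b})"
    using ghat_supermodular[of D "L - {b}"] by simp
  have "B \<noteq> D" using B D by auto
  then have ne: "\<not> D - {b} \<subseteq> B" "\<not> B \<subseteq> D - {b}" using D(2) b(1) by auto
  have eq: "D - {b} \<union> B = D" "(D - {b}) \<inter> B = B - {b}" using D(2) b(1) by auto
  have "ghat (D - {b}) + ghat B < ghat D + ghat (B - {b})"
    using ghat_supermodular_strict[OF ne] DB unfolding eq by simp
  \<comment> \<open>The coordinate \<open>x b = ghat L - ghat (L - {b})\<close> is at least
    \<open>ghat D - ghat (D - {b})\<close>, which exceeds
    \<open>ghat B - ghat (B - {b})\<close>.\<close>
  then have "tri B < sum x B"
    using 1 tight rm[OF bD(1)] rm[OF bD(2)] rm[OF b(1)] x(1)[rule_format, of "B - {b}"] ghat_block[OF B(1)]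
    by linarith
  then show ?thesis using that x(1-3) by blast
qed

end

section \<open>The nested fan and the faces of the removahedron\<close>

lemma char_vec_nth: "char_vec R $ s = (if s \<in> R then 1 else 0)"
  by (simp add: char_vec_def axis_def if_distrib[of "\<lambda>f. f _"] sum.delta cong: if_cong)

lemma inner_char_vec: "char_vec R \<bullet> x = sum (($) x) R"
  by (simp add: char_vec_def inner_sum_left inner_axis')

lemma subspace_sum_zero_space: "subspace sum_zero_space"
  unfolding sum_zero_space_def subspace_def by (auto simp: sum.distrib sum_distrib_left[symmetric])

text \<open>Projecting subtracts the mean. Any other candidate differs by a vector of the subspace
  that is orthogonal to itself.\<close>

lemma orth_proj_sum_zero_space:
  fixes x :: "real ^ 'e::finite"
  shows "orth_proj sum_zero_space x = x - (sum (($) x) UNIV / CARD('e)) *\<^sub>R char_vec UNIV"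
    (is "_ = ?v")
  unfolding orth_proj_def
proof (rule the_equality)
  have v: "?v \<in> sum_zero_space"
    by (simp add: sum_zero_space_def char_vec_nth sum_subtractf)
  have orth: "orthogonal (x - ?v) w" if "w \<in> sum_zero_space" for w
    using that by (simp add: orthogonal_def inner_char_vec sum_zero_space_def)
  then show "?v \<in> sum_zero_space \<and> (\<forall>w\<in>sum_zero_space. orthogonal (x - ?v) w)"
    using v by blast
  fix u assume u: "u \<in> sum_zero_space \<and> (\<forall>w\<in>sum_zero_space. orthogonal (x - u) w)"
  have "u - ?v \<in> sum_zero_space"
    using u v subspace_diff[OF subspace_sum_zero_space] by blast
  then have "(x - ?v) \<bullet> (u - ?v) = 0" "(x - u) \<bullet> (u - ?v) = 0"
    using u orth unfolding orthogonal_def by blast+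
  then have "(u - ?v) \<bullet> (u - ?v) = 0"
    by (simp add: inner_diff_left)
  then show "u = ?v" by simp
qed

lemma orth_proj_in: "orth_proj sum_zero_space x \<in> sum_zero_space"
  for x :: "real ^ 'e::finite"
  unfolding orth_proj_sum_zero_space
  by (simp add: sum_zero_space_def char_vec_nth sum_subtractf)

text \<open>The difference \<open>x - y\<close> lies in the subspace, so projecting \<open>a\<close>
  does not change the product.\<close>

lemma inner_orth_proj:
  fixes a x y :: "real ^ 'e::finite"
  assumes "sum (($) x) UNIV = sum (($) y) UNIV"
  shows "orth_proj sum_zero_space a \<bullet> (x - y) = a \<bullet> (x - y)"
  using assms by (simp add: orth_proj_sum_zero_space inner_diff_left inner_char_vec sum_subtractf)

text \<open>A sum over the points of \<open>R\<close>, to which \<open>sum_comps\<close>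
  applies.\<close>

lemma proj_char_vec_sum:
  "proj_char_vec R = (\<Sum>r\<in>R. axis r 1 - (1 / CARD('e)) *\<^sub>R char_vec UNIV :: real ^ 'e::finite)"
proof -
  have "proj_char_vec R = char_vec R - (card R / CARD('e)) *\<^sub>R char_vec UNIV"
    by (simp add: proj_char_vec_def orth_proj_sum_zero_space char_vec_nth sum.If_cases)
  then show ?thesis
    by (simp add: char_vec_def[of R] sum_subtractf sum_constant_scaleR del: sum_constant)
qed

lemma proj_char_vec_UNIV: "proj_char_vec UNIV = 0"
  by (simp add: proj_char_vec_def orth_proj_sum_zero_space char_vec_nth)

lemma inner_combination:
  assumes "sum (($) x) UNIV = sum (($) y) UNIV"
  shows "(\<Sum>B\<in>N. w B *\<^sub>R proj_char_vec B) \<bullet> (x - y) =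
    (\<Sum>B\<in>N. w B * (sum (($) x) B - sum (($) y) B))"
  by (simp add: inner_sum_left proj_char_vec_def inner_orth_proj[OF assms] inner_char_vec
      sum_subtractf)

section \<open>Decomposition of linear functionals and the faces cut out by nested sets\<close>

context connected_building
begin

lemma in_removahedron:
  "x \<in> removahedron \<B> \<longleftrightarrow>
    sum (($) x) UNIV = tri (UNIV :: 'e set) \<and> (\<forall>B\<in>\<B>. tri B \<le> sum (($) x) B)"
  by (simp add: removahedron_def tri_def)

lemma proj_char_vec_comps: "(\<Sum>B\<in>comps S. proj_char_vec B) = proj_char_vec S"
  unfolding proj_char_vec_sum by (rule sum_comps[symmetric])

text \<open>Shift \<open>c\<close> to be non-negative, decompose it along a chain and project, which
  kills the shift. Each set of the chain then splits into its components.\<close>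

lemma nested_decomposition:
  assumes c: "c \<in> sum_zero_space"
  obtains N w where "nested_set UNIV \<B> N" "\<And>B. B \<in> N \<Longrightarrow> w B > 0"
    "c = (\<Sum>B\<in>N. w B *\<^sub>R proj_char_vec B)"
proof -
  define m where "m = Min (range (($) c))"
  have "c $ s - m \<ge> 0" for s unfolding m_def by simp
  then obtain \<S> \<mu> where S: "chain_subset \<S>" "\<And>S. \<mu> S \<ge> 0"
    "\<And>s. c $ s - m = (\<Sum>S\<in>\<S>. if s \<in> S then \<mu> S else 0)"
    using ex_chain_decomp[of "\<lambda>s. c $ s - m"] by blast
  \<comment> \<open>A block can be a component of several sets of the chain, so its coefficients are
    collected.\<close>
  define w where "w B = (\<Sum>S\<in>\<S>. if B \<in> comps S then \<mu> S else 0)" for B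
  define N where "N = {B. w B > 0} - {UNIV}"
  have nn: "w B \<ge> 0" for B unfolding w_def using S(2) by (intro sum_nonneg) auto
  have "c - m *\<^sub>R char_vec UNIV = (\<Sum>S\<in>\<S>. \<mu> S *\<^sub>R char_vec S)"
    using S(3) by (simp add: vec_eq_iff char_vec_nth if_distrib[of "\<lambda>u. _ * u"] cong: if_cong)
  then have c_eq: "c = m *\<^sub>R char_vec UNIV + (\<Sum>S\<in>\<S>. \<mu> S *\<^sub>R char_vec S)"
    by (simp add: algebra_simps)
  have lin: "linear (orth_proj (sum_zero_space :: (real ^ 'e) set))"
    by (rule linearI) (simp_all add: orth_proj_sum_zero_space sum.distrib add_divide_distrib
        algebra_simps sum_distrib_left[symmetric])
  have "sum (($) c) UNIV = 0" using c by (simp add: sum_zero_space_def)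
  then have "c = orth_proj sum_zero_space c" by (simp add: orth_proj_sum_zero_space)
  also have "\<dots> = m *\<^sub>R proj_char_vec UNIV + (\<Sum>S\<in>\<S>. \<mu> S *\<^sub>R proj_char_vec S)"
    unfolding proj_char_vec_def
    by (subst c_eq) (simp add: linear_add[OF lin] linear_sum[OF lin] linear_scale[OF lin])
  also have "\<dots> = (\<Sum>S\<in>\<S>. \<mu> S *\<^sub>R (\<Sum>B\<in>comps S. proj_char_vec B))"
    by (simp add: proj_char_vec_comps proj_char_vec_UNIV)
  also have "\<dots> = (\<Sum>S\<in>\<S>. \<Sum>B\<in>UNIV. (if B \<in> comps S then \<mu> S else 0) *\<^sub>R proj_char_vec B)"
    unfolding scaleR_sum_right by (intro sum.cong refl sum.mono_neutral_cong_left) auto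
  also have "\<dots> = (\<Sum>B\<in>UNIV. w B *\<^sub>R proj_char_vec B)"
    unfolding w_def by (subst sum.swap) (simp add: scaleR_left.sum)
  also have "\<dots> = (\<Sum>B\<in>N. w B *\<^sub>R proj_char_vec B)"
    by (rule sum.mono_neutral_right)
      (use nn in \<open>auto simp: N_def proj_char_vec_UNIV order_less_le\<close>)
  finally have "c = (\<Sum>B\<in>N. w B *\<^sub>R proj_char_vec B)" .
  moreover have "N \<subseteq> chain_nested \<S>"
  proof
    fix B assume "B \<in> N"
    then have "w B \<noteq> 0" "B \<noteq> UNIV" by (auto simp: N_def)
    then show "B \<in> chain_nested \<S>"
      unfolding w_def chain_nested_def by (auto elim: sum.not_neutral_contains_not_neutral split: if_splits)
  qed
  then have "nested_set UNIV \<B> N"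
    using nested_set_subset[OF nested_chain_nested[OF S(1)]] by blast
  moreover have "w B > 0" if "B \<in> N" for B using that by (simp add: N_def)
  ultimately show ?thesis using that by blast
qed

definition nested_face :: "'e set set \<Rightarrow> (real ^ 'e) set" where
  "nested_face N = {x \<in> removahedron \<B>. \<forall>B\<in>N. sum (($) x) B = tri B}"

lemma polyhedron_removahedron: "polyhedron (removahedron \<B>)"
proof -
  have "removahedron \<B> = {x. char_vec UNIV \<bullet> x = tri (UNIV :: 'e set)} \<inter>
      \<Inter>((\<lambda>B. {x. char_vec B \<bullet> x \<ge> tri B}) ` \<B>)"
    by (auto simp: in_removahedron inner_char_vec)
  moreover have "polyhedron (\<Inter>((\<lambda>B. {x. char_vec B \<bullet> x \<ge> tri B}) ` \<B>))"
    by (intro polyhedron_Inter) (auto intro: polyhedron_halfspace_ge)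
  ultimately show ?thesis by (auto intro: polyhedron_hyperplane)
qed

text \<open>Summing the inequalities of the members of \<open>N\<close> gives a supporting
  hyperplane, met exactly where all of them are tight.\<close>

lemma nested_face_face_of:
  assumes "N \<subseteq> \<B>" shows "nested_face N face_of removahedron \<B>"
proof -
  let ?a = "\<Sum>B\<in>N. char_vec B" and ?b = "\<Sum>B\<in>N. tri B"
  have a: "?a \<bullet> x - ?b = (\<Sum>B\<in>N. sum (($) x) B - tri B)" for x
    by (simp add: inner_sum_left inner_char_vec sum_subtractf)
  have nn: "sum (($) x) B - tri B \<ge> 0" if "x \<in> removahedron \<B>" "B \<in> N" for x B
    using that assms by (auto simp: in_removahedron)
  have "?a \<bullet> x - ?b \<ge> 0" if "x \<in> removahedron \<B>" for x
    unfolding a using nn[OF that] by (rule sum_nonneg)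
  then have "(removahedron \<B> \<inter> {x. ?a \<bullet> x = ?b}) face_of removahedron \<B>"
    using polyhedron_imp_convex[OF polyhedron_removahedron]
    by (intro face_of_Int_supporting_hyperplane_ge) auto
  moreover have "?a \<bullet> x = ?b \<longleftrightarrow> (\<forall>B\<in>N. sum (($) x) B = tri B)" if "x \<in> removahedron \<B>" for x
    using sum_nonneg_eq_0_iff[of N "\<lambda>B. sum (($) x) B - tri B"] nn[OF that] a[of x] by auto
  then have "removahedron \<B> \<inter> {x. ?a \<bullet> x = ?b} = nested_face N"
    unfolding nested_face_def by auto
  ultimately show ?thesis by simp
qed

text \<open>The difference \<open>c \<bullet> x - c \<bullet> z\<close> is the sum of the slacks of
  \<open>x\<close> with positive weights \<open>w\<close>, so \<open>c\<close> is minimal exactly on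
  \<open>nested_face N\<close>.\<close>

lemma combination_minimal:
  assumes N: "N \<subseteq> \<B>" "\<And>B. B \<in> N \<Longrightarrow> w B > 0"
    and c: "c = (\<Sum>B\<in>N. w B *\<^sub>R proj_char_vec B)"
    and z: "z \<in> nested_face N" and x: "x \<in> removahedron \<B>"
  shows "c \<bullet> z \<le> c \<bullet> x" and "c \<bullet> x \<le> c \<bullet> z \<longleftrightarrow> x \<in> nested_face N"
proof -
  have zP: "z \<in> removahedron \<B>" "\<And>B. B \<in> N \<Longrightarrow> sum (($) z) B = tri B"
    using z unfolding nested_face_def by auto
  have tot: "sum (($) x) UNIV = sum (($) z) UNIV" using x zP(1) by (simp add: in_removahedron)
  then have eq: "c \<bullet> x - c \<bullet> z = (\<Sum>B\<in>N. w B * (sum (($) x) B - tri B))"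
    unfolding c inner_diff_right[symmetric] inner_combination[OF tot] using zP(2) by simp
  have nn: "w B * (sum (($) x) B - tri B) \<ge> 0" if "B \<in> N" for B
    using that N x by (intro mult_nonneg_nonneg) (auto simp: in_removahedron less_imp_le)
  then have nns: "(\<Sum>B\<in>N. w B * (sum (($) x) B - tri B)) \<ge> 0" by (rule sum_nonneg)
  then show "c \<bullet> z \<le> c \<bullet> x" using eq by simp
  have "c \<bullet> x \<le> c \<bullet> z \<longleftrightarrow> (\<Sum>B\<in>N. w B * (sum (($) x) B - tri B)) = 0"
    using eq nns by auto
  also have "\<dots> \<longleftrightarrow> (\<forall>B\<in>N. w B * (sum (($) x) B - tri B) = 0)"
    by (rule sum_nonneg_eq_0_iff) (use nn in auto)
  also have "\<dots> \<longleftrightarrow> x \<in> nested_face N"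
    using x N(2) unfolding nested_face_def by force
  finally show "c \<bullet> x \<le> c \<bullet> z \<longleftrightarrow> x \<in> nested_face N" .
qed

end

section \<open>Normal cones and the classification of faces\<close>

context exchange_closed_building
begin

lemma vec_in_removahedron:
  assumes "\<And>S. ghat S \<le> sum x S" "sum x UNIV = tri (UNIV :: 'e set)"
  shows "(\<chi> s. x s) \<in> removahedron \<B>"
proof -
  have "tri B \<le> sum x B" if "B \<in> \<B>" for B
    using assms(1)[of B] ghat_block[OF that] by simp
  then show ?thesis using assms(2) by (simp add: in_removahedron)
qed

lemma nested_face_nonempty:
  assumes "nested_set UNIV \<B> N" obtains z where "z \<in> nested_face N"
proof -
  obtain x :: "'e \<Rightarrow> real" where x: "\<forall>S. ghat S \<le> sum x S" "sum x UNIV = tri (UNIV :: 'e set)"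
    "\<forall>A\<in>N. sum x A = tri A"
    \<comment> \<open>\<open>undefined\<close> is an arbitrary element: the members of
      \<open>N\<close> are tight for every choice of \<open>b\<close>.\<close>
    using nested_greedy[OF assms, of undefined] by (elim exE conjE) (rule that)
  then have "(\<chi> s. x s) \<in> nested_face N"
    using vec_in_removahedron unfolding nested_face_def by auto
  then show ?thesis using that by blast
qed

lemma nested_face_subset:
  assumes N: "nested_set UNIV \<B> N" and M: "nested_set UNIV \<B> M"
    and sub: "nested_face N \<subseteq> nested_face M"
  shows "M \<subseteq> N"
proof (rule ccontr)
  assume "\<not> M \<subseteq> N"
  then obtain B where B: "B \<in> M" "B \<notin> N" by auto
  then have "B \<in> \<B>" "B \<noteq> UNIV" using nested_setD(1,2)[OF M] by auto
  then obtain x :: "'e \<Rightarrow> real" where x: "\<And>S. ghat S \<le> sum x S" "sum x UNIV = tri (UNIV :: 'e set)"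
    "\<And>A. A \<in> N \<Longrightarrow> sum x A = tri A" "tri B < sum x B"
    using nested_slack[OF N _ _ B(2)] by metis
  then have "(\<chi> s. x s) \<in> nested_face N"
    using vec_in_removahedron unfolding nested_face_def by auto
  then have "(\<chi> s. x s) \<in> nested_face M" using sub by blast
  then show False using B(1) x(4) unfolding nested_face_def by force
qed

text \<open>Write a functional \<open>c\<close> of the normal cone over a nested set
  \<open>M\<close>. Points of \<open>nested_face N\<close> minimize \<open>c\<close> and hence lie
  in \<open>nested_face M\<close>, so \<open>M \<subseteq> N\<close> by
  \<open>nested_face_subset\<close>.\<close>

lemma normal_cone_nested_face:
  assumes N: "nested_set UNIV \<B> N"
  shows "normal_cone sum_zero_space (removahedron \<B>) (nested_face N) =
    convex_cone hull (proj_char_vec ` N)" (is "?K = _")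
proof (rule subset_antisym)
  have "convex_cone ?K"
    unfolding convex_cone_iff normal_cone_def
    using subspace_sum_zero_space[unfolded subspace_def]
    by (auto simp: inner_add_left intro!: add_mono mult_left_mono)
  moreover have "proj_char_vec B \<in> ?K" if "B \<in> N" for B
  proof -
    have "proj_char_vec B \<bullet> x \<le> proj_char_vec B \<bullet> y"
      if "x \<in> nested_face N" "y \<in> removahedron \<B>" for x y
    \<comment> \<open>A single generator is the combination over \<open>{B}\<close> with weight
      1.\<close>
    proof (rule combination_minimal(1)[where N = "{B}" and w = "\<lambda>_. 1"])
      show "x \<in> nested_face {B}" using that(1) \<open>B \<in> N\<close> unfolding nested_face_def by auto
    qed (use \<open>B \<in> N\<close> nested_setD(1)[OF N] that in auto)
    then show ?thesis
      unfolding normal_cone_def by (simp add: proj_char_vec_def orth_proj_in)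
  qed
  ultimately show "convex_cone hull (proj_char_vec ` N) \<subseteq> ?K"
    by (intro hull_minimal) auto
next
  show "?K \<subseteq> convex_cone hull (proj_char_vec ` N)"
  proof
    fix c assume c: "c \<in> ?K"
    then have "c \<in> sum_zero_space" by (simp add: normal_cone_def)
    then obtain M w where M: "nested_set UNIV \<B> M" and pos: "\<And>B. B \<in> M \<Longrightarrow> w B > 0"
      and c_eq: "c = (\<Sum>B\<in>M. w B *\<^sub>R proj_char_vec B)"
      using nested_decomposition by metis
    obtain z where z: "z \<in> nested_face M" using nested_face_nonempty[OF M] .
    have "x \<in> nested_face M" if x: "x \<in> nested_face N" for x
    proof -
      have "x \<in> removahedron \<B>" "z \<in> removahedron \<B>" using x z unfolding nested_face_def by auto
      moreover have "c \<bullet> x \<le> c \<bullet> z" using c x calculation unfolding normal_cone_def by auto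
      ultimately show ?thesis
        using combination_minimal(2)[OF nested_setD(1)[OF M] pos c_eq z] by blast
    qed
    then have "M \<subseteq> N" using nested_face_subset[OF N M] by blast
    have "(\<Sum>B\<in>F. w B *\<^sub>R proj_char_vec B) \<in> convex_cone hull (proj_char_vec ` N)"
      if "F \<subseteq> M" for F
      using finite[of F] that
    proof (induction F rule: finite_induct)
      case empty
      then show ?case by (simp add: convex_cone_hull_contains_0)
    next
      case (insert B F)
      then have "proj_char_vec B \<in> convex_cone hull (proj_char_vec ` N)"
        using \<open>M \<subseteq> N\<close> by (intro hull_inc) auto
      then have "w B *\<^sub>R proj_char_vec B \<in> convex_cone hull (proj_char_vec ` N)"
        using pos[of B] insert.prems by (intro convex_cone_hull_mul) auto
      then show ?case using insert by (simp add: convex_cone_hull_add)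
    qed
    then show "c \<in> convex_cone hull (proj_char_vec ` N)" using c_eq by blast
  qed
qed

text \<open>Faces of a polyhedron are exposed, and the exposing functional decomposes over a nested
  set whose face is its set of minimizers.\<close>

lemma face_is_nested_face:
  assumes F: "F face_of removahedron \<B>" "F \<noteq> {}"
  obtains N where "nested_set UNIV \<B> N" "F = nested_face N"
proof -
  have "F exposed_face_of removahedron \<B>"
    using F exposed_face_of_polyhedron[OF polyhedron_removahedron] by blast
  then obtain a b where ab: "removahedron \<B> \<subseteq> {x. a \<bullet> x \<le> b}"
    "F = removahedron \<B> \<inter> {x. a \<bullet> x = b}" unfolding exposed_face_of_def by auto
  \<comment> \<open>The exposed face maximizes \<open>a\<close>, while
    \<open>combination_minimal\<close> is about minima; hence the sign.\<close>
  define c where "c = orth_proj sum_zero_space (- a)"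
  have ca: "c \<bullet> x \<le> c \<bullet> y \<longleftrightarrow> a \<bullet> y \<le> a \<bullet> x"
    if "x \<in> removahedron \<B>" "y \<in> removahedron \<B>" for x y
  proof -
    have "c \<bullet> x - c \<bullet> y = a \<bullet> y - a \<bullet> x"
      using inner_orth_proj[of x y "- a"] that
      unfolding c_def by (simp add: in_removahedron inner_diff_right)
    then show ?thesis by linarith
  qed
  obtain N w where N: "nested_set UNIV \<B> N" and pos: "\<And>B. B \<in> N \<Longrightarrow> w B > 0"
    and c_eq: "c = (\<Sum>B\<in>N. w B *\<^sub>R proj_char_vec B)"
    using nested_decomposition[of c] orth_proj_in unfolding c_def by metis
  obtain z where z: "z \<in> nested_face N" using nested_face_nonempty[OF N] .
  then have zP: "z \<in> removahedron \<B>" unfolding nested_face_def by auto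
  have le: "c \<bullet> z \<le> c \<bullet> x" and iff: "c \<bullet> x \<le> c \<bullet> z \<longleftrightarrow> x \<in> nested_face N"
    if "x \<in> removahedron \<B>" for x
    using combination_minimal[OF nested_setD(1)[OF N] pos c_eq z that] by auto
  obtain y where y: "y \<in> removahedron \<B>" "a \<bullet> y = b" using F ab by auto
  have "a \<bullet> z = b"
    using le[OF y(1)] ca[OF zP y(1)] ab(1) zP y by auto
  then have "x \<in> F \<longleftrightarrow> x \<in> nested_face N" if "x \<in> removahedron \<B>" for x
    using iff[OF that] ca[OF that zP] ab that by auto
  then have "F = nested_face N"
    using ab(2) unfolding nested_face_def by blast
  then show ?thesis using that N by blast
qed

end

theorem theorem2p18:
  fixes \<B> :: "'e::finite set set"
  assumes "connected_building_set UNIV \<B>"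
    and "\<And>B B'. B \<in> \<B> \<Longrightarrow> B' \<in> \<B> \<Longrightarrow> exchangeable UNIV \<B> B B' \<Longrightarrow> B \<inter> B' \<in> \<B> \<union> {{}}"
  shows "normal_fan sum_zero_space (removahedron \<B>) = nested_fan \<B>"
proof -
  interpret exchange_closed_building \<B>
    using assms by unfold_locales
  show ?thesis
  proof (rule subset_antisym)
    show "normal_fan sum_zero_space (removahedron \<B>) \<subseteq> nested_fan \<B>"
    proof
      fix K assume "K \<in> normal_fan sum_zero_space (removahedron \<B>)"
      then obtain F where F: "F face_of removahedron \<B>" "F \<noteq> {}"
        "K = normal_cone sum_zero_space (removahedron \<B>) F" unfolding normal_fan_def by blast
      obtain N where "nested_set UNIV \<B> N" "F = nested_face N"
        using face_is_nested_face[OF F(1,2)] .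
      then show "K \<in> nested_fan \<B>"
        unfolding nested_fan_def F(3) using normal_cone_nested_face by blast
    qed
    show "nested_fan \<B> \<subseteq> normal_fan sum_zero_space (removahedron \<B>)"
    proof
      fix K assume "K \<in> nested_fan \<B>"
      then obtain N where N: "nested_set UNIV \<B> N" "K = convex_cone hull (proj_char_vec ` N)"
        unfolding nested_fan_def by blast
      have "nested_face N \<noteq> {}" using nested_face_nonempty[OF N(1)] by blast
      then show "K \<in> normal_fan sum_zero_space (removahedron \<B>)"
        unfolding normal_fan_def N(2) normal_cone_nested_face[OF N(1), symmetric]
        using nested_face_face_of[OF nested_setD(1)[OF N(1)]] by blast
    qed
  qed
qed

end
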